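(* Let $d\ge1$ be an integer and let $E\subset\mathbb R^d$ be a bounded set. If $E$ is box mean porous, then the Minkowski dimension of $E$ satisfies $\operatorname{MD}(E)<d$.
   Context: For an integer $n$, let $\mathcal B_n$ be the covering of $\mathbb R^d$ by the boxes $[p_1 2^{-n},(p_1+1)2^{-n})\times\cdots\times[p_d 2^{-n},(p_d+1)2^{-n})$, over all sequences of integers $p_1,\dots,p_d$. For $z\in E$, $Q(z,n)$ denotes the element of $\mathcal B_n$ containing $z$. Box mean porous: a set $E\subset\mathbb R^d$ is called box mean porous if there exist a positive integer $N$ and a number $P>0$ and, for all $z\in E$, a strictly increasing sequence $(n_j)_{j\ge1}$ of nonnegative integers with $n_j\le Pj$ and boxes $Q_j\in\mathcal B_{n_j+N}$ such that $Q_j\subset Q(z,n_j)\setminus E$ for all $j$ (the constants $N,P$ do not depend on $z$). $\operatorname{MD}(E)$ denotes the Minkowski dimension, i.e. the (upper) box-counting dimension, of $E$. *)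

theory Defs
  imports "HOL-Analysis.Analysis"
begin

definition dyadic_boxes :: "int \<Rightarrow> (real ^ 'd) set set" where
  "dyadic_boxes n =
     range (\<lambda>p :: int ^ 'd.
       {x. \<forall>i. of_int (p $ i) * 2 powi (- n) \<le> x $ i \<and>
                x $ i < (of_int (p $ i) + 1) * 2 powi (- n)})"

definition dyadic_box_at :: "real ^ 'd \<Rightarrow> int \<Rightarrow> (real ^ 'd) set" where
  "dyadic_box_at z n = (THE Q. Q \<in> dyadic_boxes n \<and> z \<in> Q)"

text \<open>Sequences are indexed from 1; the values of \<open>n\<close> and \<open>Q\<close> at 0 are irrelevant.\<close>

definition box_mean_porous :: "(real ^ 'd) set \<Rightarrow> bool" where
  "box_mean_porous E \<longleftrightarrow>
     (\<exists>(N :: nat) (P :: real). N > 0 \<and> P > 0 \<and>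
       (\<forall>z\<in>E. \<exists>(n :: nat \<Rightarrow> nat) (Q :: nat \<Rightarrow> (real ^ 'd) set).
          strict_mono_on {1..} n \<and>
          (\<forall>j\<ge>1. real (n j) \<le> P * real j \<and>
                  Q j \<in> dyadic_boxes (int (n j + N)) \<and>
                  Q j \<subseteq> dyadic_box_at z (int (n j)) - E)))"

text \<open>The least number of closed balls of radius \<open>r\<close> that cover \<open>E\<close>. It is meaningful for
  bounded \<open>E\<close> and \<open>r > 0\<close>; otherwise a finite cover need not exist.\<close>

definition covering_number :: "'a :: metric_space set \<Rightarrow> real \<Rightarrow> nat" where
  "covering_number E r =
     (LEAST k. \<exists>C. finite C \<and> card C = k \<and> E \<subseteq> (\<Union>x\<in>C. cball x r))"

text \<open>The upper Minkowski (box-counting) dimension of a bounded set, where \<open>r\<close> tends to 0 through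
  all positive reals. Since \<open>ln 0 = 0\<close>, the empty set gets dimension 0.\<close>

definition minkowski_dim :: "'a :: metric_space set \<Rightarrow> ereal" where
  "minkowski_dim E =
     Limsup (at_right 0) (\<lambda>r. ereal (ln (real (covering_number E r)) / ln (1 / r)))"

end

theory Submission
  imports Defs
begin

text \<open>
  The dyadic boxes form a tree in which a box of level \<open>n\<close> has \<open>D = 2 ^ (N * d)\<close> descendants of
  level \<open>n + N\<close>. Call a box \<^emph>\<open>holed\<close> if one of these descendants misses \<open>E\<close>. Being holed is a
  property of the box alone, not of a point in it, and porosity says that on the way down to any
  point of \<open>E\<close> at least about \<open>L / P\<close> of the first \<open>L\<close> boxes are holed. So the tree of boxes
  that meet \<open>E\<close> fails to branch fully at a positive proportion of the levels on every path.

  To turn this into a count, each box is weighted by \<open>lam ^ h\<close>, where \<open>h\<close> counts its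
  holed ancestors and \<open>lam = D / (D - 1)\<close>. A box that is not holed has at most \<open>D\<close> descendants of the
  same weight; a holed one has at most \<open>D - 1\<close>, whose weight is larger by the factor \<open>lam\<close>. In
  both cases the total weight grows at most by the factor \<open>D\<close> (\<open>card_rarely_branching\<close>), while each
  box that meets \<open>E\<close> has exponentially large weight. Hence there are exponentially fewer than \<open>D ^ k\<close>
  boxes of level \<open>k * N\<close> that meet \<open>E\<close> (\<open>box_mean_porous_few_boxes\<close>), which bounds the dimension
  away from \<open>d\<close> (\<open>minkowski_dim_le\<close>).

  The argument steps through \<open>N\<close> levels at a time and therefore sees only the levels in one residue
  class modulo \<open>N\<close>. By the pigeonhole principle each point has a residue class that contains at
  least the fraction \<open>1 / N\<close> of its holed levels; which class depends on the point, so the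
  bounds for the \<open>N\<close> classes are added up.
\<close>

section \<open>Counting in a tree with missing children\<close>

text \<open>
  The points of \<open>E\<close> are the branches of a tree; \<open>f k z\<close> is the vertex of depth \<open>k\<close> on the branch \<open>z\<close>
  and \<open>g\<close> is the parent map. Every vertex has at most \<open>D\<close> children, and those in \<open>H\<close> have fewer.
  The vertices reached after at least \<open>t\<close> passages through \<open>H\<close> have weight at least
  \<open>(D / (D - 1)) powr t\<close> each, and the total weight at depth \<open>k\<close> is at most \<open>D ^ k\<close> times that of
  the roots.
\<close>

lemma card_rarely_branching:
  fixes f :: "nat \<Rightarrow> 'z \<Rightarrow> 'a" and g :: "'a \<Rightarrow> 'a" and H :: "nat \<Rightarrow> 'a set"
    and D :: nat and t :: real
  assumes fin: "\<And>k. finite (f k ` E)"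
    and parent: "\<And>k z. z \<in> E \<Longrightarrow> g (f (Suc k) z) = f k z"
    and children: "\<And>k p. card {q \<in> f (Suc k) ` E. g q = p} \<le> D"
    and missing: "\<And>k p. p \<in> H k \<Longrightarrow> card {q \<in> f (Suc k) ` E. g q = p} < D"
    and D: "D \<ge> 2"
  shows "real (card (f k ` {z \<in> E. t \<le> real (card {i. i < k \<and> f i z \<in> H i})}))
           * (real D / (real D - 1)) powr t \<le> real D ^ k * real (card (f 0 ` E))"
proof -
  define lam where "lam = real D / (real D - 1)"
  have lam: "lam \<ge> 1" "lam * (real D - 1) = real D"
    using D by (auto simp: lam_def field_simps)
  \<comment> \<open>A vertex determines its ancestors, so the weight is a function of the vertex, not of the
    branch; the recursion along the parent map makes this evident.\<close>
  define w where "w = rec_nat (\<lambda>q. 1) (\<lambda>k v q. v (g q) * (if g q \<in> H k then lam else 1))"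
  have w0: "w 0 q = 1" for q by (simp add: w_def)
  have wS: "w (Suc k) q = w k (g q) * (if g q \<in> H k then lam else 1)" for k q
    by (simp add: w_def)
  have w_pos: "w k q \<ge> 1" for k q
  proof (induction k arbitrary: q)
    case (Suc k)
    have "1 * 1 \<le> w k (g q) * (if g q \<in> H k then lam else 1)"
      by (intro mult_mono Suc) (use lam Suc[of "g q"] in auto)
    then show ?case by (simp add: wS)
  qed (simp add: w0)
  have w_eq: "w k (f k z) = lam ^ card {i. i < k \<and> f i z \<in> H i}" if z: "z \<in> E" for k z
  proof (induction k)
    case (Suc k)
    have "{i. i < Suc k \<and> f i z \<in> H i} =
        (if f k z \<in> H k then insert k {i. i < k \<and> f i z \<in> H i} else {i. i < k \<and> f i z \<in> H i})"
      by (auto simp: less_Suc_eq)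
    then show ?case by (simp add: wS parent[OF z] Suc)
  qed (simp add: w0)
  have step: "(\<Sum>q\<in>f (Suc k) ` E. w (Suc k) q) \<le> real D * (\<Sum>p\<in>f k ` E. w k p)" for k
  proof -
    have "(\<Sum>q\<in>f (Suc k) ` E. w (Suc k) q)
        = (\<Sum>p\<in>f k ` E. \<Sum>q\<in>{q \<in> f (Suc k) ` E. g q = p}. w (Suc k) q)"
      by (rule sum.group[symmetric]) (use fin parent in auto)
    also have "\<dots> \<le> (\<Sum>p\<in>f k ` E. real D * w k p)"
    proof (rule sum_mono)
      fix p
      let ?c = "card {q \<in> f (Suc k) ` E. g q = p}"
      have "(\<Sum>q\<in>{q \<in> f (Suc k) ` E. g q = p}. w (Suc k) q)
          = (\<Sum>q\<in>{q \<in> f (Suc k) ` E. g q = p}. w k p * (if p \<in> H k then lam else 1))"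
        by (intro sum.cong) (auto simp: wS)
      also have "\<dots> = (real ?c * (if p \<in> H k then lam else 1)) * w k p" by simp
      also have "\<dots> \<le> real D * w k p"
      proof (rule mult_right_mono)
        show "real ?c * (if p \<in> H k then lam else 1) \<le> real D"
        proof (cases "p \<in> H k")
          case True
          \<comment> \<open>The gain in weight cancels the missing child exactly.\<close>
          have "real ?c \<le> real D - 1" using missing[OF True] by linarith
          then have "real ?c * lam \<le> (real D - 1) * lam" using lam by (intro mult_right_mono) auto
          then show ?thesis using True lam by (simp add: mult.commute)
        qed (use children in auto)
        show "0 \<le> w k p" using w_pos[of k p] by linarith
      qed
      finally show "(\<Sum>q\<in>{q \<in> f (Suc k) ` E. g q = p}. w (Suc k) q) \<le> real D * w k p" .
    qed
    also have "\<dots> = real D * (\<Sum>p\<in>f k ` E. w k p)" by (simp add: sum_distrib_left)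
    finally show ?thesis .
  qed
  have total: "(\<Sum>q\<in>f k ` E. w k q) \<le> real D ^ k * real (card (f 0 ` E))" for k
  proof (induction k)
    case (Suc k)
    have "real D * (\<Sum>q\<in>f k ` E. w k q) \<le> real D * (real D ^ k * real (card (f 0 ` E)))"
      by (intro mult_left_mono Suc) auto
    with step[of k] show ?case by (simp add: mult.assoc)
  qed (simp add: w0)
  let ?G = "f k ` {z \<in> E. t \<le> real (card {i. i < k \<and> f i z \<in> H i})}"
  have "real (card ?G) * lam powr t = (\<Sum>q\<in>?G. lam powr t)" by simp
  also have "\<dots> \<le> (\<Sum>q\<in>?G. w k q)"
  proof (rule sum_mono)
    fix q assume "q \<in> ?G"
    then obtain z where z: "z \<in> E" "q = f k z" "t \<le> real (card {i. i < k \<and> f i z \<in> H i})"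
      by auto
    have "lam powr t \<le> lam powr real (card {i. i < k \<and> f i z \<in> H i})"
      using lam z(3) by (intro powr_mono) auto
    then show "lam powr t \<le> w k q" using lam z w_eq[OF z(1)] by (simp add: powr_realpow)
  qed
  also have "\<dots> \<le> (\<Sum>q\<in>f k ` E. w k q)"
  proof (rule sum_mono2[OF fin])
    show "0 \<le> w k b" for b using w_pos[of k b] by linarith
  qed auto
  finally show ?thesis using total[of k] by (simp add: lam_def)
qed

section \<open>Dyadic boxes as integer vectors\<close>

text \<open>
  Boxes are handled through the integer vectors that index them, so that passing to a larger box
  becomes integer division and boxes can be counted as integer points.
\<close>

definition grid_index :: "nat \<Rightarrow> real ^ 'd \<Rightarrow> int ^ 'd" where
  "grid_index n z = (\<chi> i. \<lfloor>2 ^ n * z $ i\<rfloor>)"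

definition coarsen :: "nat \<Rightarrow> int ^ 'd \<Rightarrow> int ^ 'd" where
  "coarsen k q = (\<chi> i. q $ i div 2 ^ k)"

lemma coarsen_grid_index: "coarsen k (grid_index (n + k) z) = grid_index n z"
proof -
  have "\<lfloor>2 ^ (n + k) * x\<rfloor> div 2 ^ k = \<lfloor>2 ^ n * x\<rfloor>" for x :: real
    using floor_divide_real_eq_div[of "2 ^ k" "2 ^ (n + k) * x"] by (simp add: power_add)
  then show ?thesis by (simp add: coarsen_def grid_index_def)
qed

lemma dyadic_boxes_eq: "dyadic_boxes (int n) = range (\<lambda>p. {x. grid_index n x = p})"
proof -
  have "a * 2 powi (- int n) \<le> x \<longleftrightarrow> a \<le> 2 ^ n * x"
    "x < a * 2 powi (- int n) \<longleftrightarrow> 2 ^ n * x < a" for a x :: real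
    by (simp_all add: power_int_minus field_simps)
  then show ?thesis
    by (simp add: dyadic_boxes_def grid_index_def vec_eq_iff floor_eq_iff)
qed

lemma dyadic_box_at_eq: "dyadic_box_at z (int n) = {x. grid_index n x = grid_index n z}"
  unfolding dyadic_box_at_def by (rule the_equality) (auto simp: dyadic_boxes_eq)

lemma grid_index_corner: "grid_index n (\<chi> i. real_of_int (q $ i) / 2 ^ n) = q"
  by (simp add: grid_index_def vec_eq_iff)

lemma card_int_cube:
  fixes a :: "int ^ 'd"
  shows "card {q :: int ^ 'd. \<forall>i. q $ i \<in> {a $ i..<a $ i + int m}} = m ^ CARD('d)"
    and "finite {q :: int ^ 'd. \<forall>i. q $ i \<in> {a $ i..<a $ i + int m}}"
proof -
  let ?F = "PiE UNIV (\<lambda>i. {a $ i..<a $ i + int m})"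
  have eq: "{q :: int ^ 'd. \<forall>i. q $ i \<in> {a $ i..<a $ i + int m}} = vec_lambda ` ?F"
  proof (intro set_eqI iffI)
    fix q :: "int ^ 'd" assume "q \<in> {q. \<forall>i. q $ i \<in> {a $ i..<a $ i + int m}}"
    then have "vec_nth q \<in> ?F" by auto
    then have "vec_lambda (vec_nth q) \<in> vec_lambda ` ?F" by (rule imageI)
    then show "q \<in> vec_lambda ` ?F" by (simp add: vec_nth_inverse)
  qed (auto simp: PiE_iff)
  have "inj_on vec_lambda ?F" by (auto simp: inj_on_def vec_lambda_inject)
  then show "card {q :: int ^ 'd. \<forall>i. q $ i \<in> {a $ i..<a $ i + int m}} = m ^ CARD('d)"
    unfolding eq by (simp add: card_image card_PiE)
  show "finite {q :: int ^ 'd. \<forall>i. q $ i \<in> {a $ i..<a $ i + int m}}"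
    unfolding eq by (intro finite_imageI finite_PiE) auto
qed

lemma card_coarsen_fibre:
  fixes p :: "int ^ 'd"
  shows "card {q. coarsen k q = p} = 2 ^ (k * CARD('d))" and "finite {q. coarsen k q = p}"
proof -
  have iff: "c div 2 ^ k = b \<longleftrightarrow> 2 ^ k * b \<le> c \<and> c < 2 ^ k * b + 2 ^ k" for b c :: int
  proof
    assume "c div 2 ^ k = b"
    then have "c = 2 ^ k * b + c mod 2 ^ k" by (metis mult_div_mod_eq)
    moreover have "0 \<le> c mod 2 ^ k" "c mod 2 ^ k < 2 ^ k" by simp_all
    ultimately show "2 ^ k * b \<le> c \<and> c < 2 ^ k * b + 2 ^ k" by linarith
  next
    assume "2 ^ k * b \<le> c \<and> c < 2 ^ k * b + 2 ^ k"
    then show "c div 2 ^ k = b"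
      by (intro int_div_pos_eq[where r = "c - 2 ^ k * b"]) auto
  qed
  have "{q. coarsen k q = p}
      = {q. \<forall>i. q $ i \<in> {(\<chi> i. 2 ^ k * p $ i) $ i..<(\<chi> i. 2 ^ k * p $ i) $ i + int (2 ^ k)}}"
    by (simp add: coarsen_def vec_eq_iff iff)
  then show "card {q. coarsen k q = p} = 2 ^ (k * CARD('d))" "finite {q. coarsen k q = p}"
    using card_int_cube[of "\<chi> i. 2 ^ k * p $ i" "2 ^ k"] by (simp_all add: power_mult)
qed

lemma finite_grid_index_image:
  fixes E :: "(real ^ 'd) set"
  assumes "bounded E"
  shows "finite (grid_index n ` E)"
proof -
  obtain B where B: "\<And>z. z \<in> E \<Longrightarrow> norm z \<le> B" using assms by (auto simp: bounded_iff)
  define M where "M = nat (\<lceil>2 ^ n * B\<rceil> + 1)"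
  have "grid_index n z \<in> {q. \<forall>i. q $ i \<in> {(\<chi> i. - int M) $ i..<(\<chi> i. - int M) $ i + int (2 * M)}}"
    if "z \<in> E" for z
  proof -
    have "- int M \<le> \<lfloor>2 ^ n * z $ i\<rfloor> \<and> \<lfloor>2 ^ n * z $ i\<rfloor> < int M" for i
    proof -
      have "\<bar>z $ i\<bar> \<le> B" using component_le_norm_cart[of z i] B[OF that] by linarith
      then have "2 ^ n * \<bar>z $ i\<bar> \<le> 2 ^ n * B" by simp
      then have "\<bar>2 ^ n * z $ i\<bar> \<le> 2 ^ n * B" by (simp add: abs_mult)
      moreover have "0 \<le> B" using B[OF that] norm_ge_zero order_trans by blast
      then have "0 \<le> \<lceil>2 ^ n * B\<rceil>" by (simp add: less_le_trans[of "-1" 0])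
      ultimately show ?thesis unfolding M_def by linarith
    qed
    then show ?thesis by (simp add: grid_index_def)
  qed
  then show ?thesis by (intro finite_subset[OF _ card_int_cube(2)]) blast
qed

text \<open>
  The box of level \<open>n\<close> lies in a ball around its lower corner. The radius comes from bounding the
  Euclidean norm by the \<open>l1\<close> norm; the constant has no influence on the dimension.
\<close>

lemma cover_by_grid_cells:
  fixes E :: "(real ^ 'd) set"
  assumes "bounded E"
  shows "\<exists>C. finite C \<and> card C \<le> card (grid_index n ` E) \<and>
           E \<subseteq> (\<Union>x\<in>C. cball x (real CARD('d) / 2 ^ n))"
proof (intro exI conjI)
  let ?corner = "\<lambda>q :: int ^ 'd. (\<chi> i. real_of_int (q $ i) / 2 ^ n) :: real ^ 'd"
  let ?C = "?corner ` grid_index n ` E"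
  show "finite ?C" "card ?C \<le> card (grid_index n ` E)"
    using finite_grid_index_image[OF assms] by (auto intro: card_image_le)
  show "E \<subseteq> (\<Union>x\<in>?C. cball x (real CARD('d) / 2 ^ n))"
  proof
    fix z assume z: "z \<in> E"
    let ?x = "?corner (grid_index n z)"
    have "norm (?x - z) \<le> (\<Sum>i\<in>UNIV. \<bar>(?x - z) $ i\<bar>)" by (rule norm_le_l1_cart)
    also have "\<dots> \<le> (\<Sum>i\<in>(UNIV :: 'd set). 1 / 2 ^ n)"
    proof (rule sum_mono)
      fix i
      have "(?x - z) $ i = (real_of_int \<lfloor>2 ^ n * z $ i\<rfloor> - 2 ^ n * z $ i) / 2 ^ n"
        by (simp add: grid_index_def field_simps)
      moreover have "\<bar>real_of_int \<lfloor>2 ^ n * z $ i\<rfloor> - 2 ^ n * z $ i\<bar> \<le> 1" by linarith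
      ultimately show "\<bar>(?x - z) $ i\<bar> \<le> 1 / 2 ^ n" by (simp add: divide_right_mono)
    qed
    also have "\<dots> = real CARD('d) / 2 ^ n" by simp
    finally show "z \<in> (\<Union>x\<in>?C. cball x (real CARD('d) / 2 ^ n))"
      using z by (auto simp: dist_norm)
  qed
qed

section \<open>Counting the dyadic boxes that meet a box mean porous set\<close>

definition holed :: "(real ^ 'd) set \<Rightarrow> nat \<Rightarrow> nat \<Rightarrow> (int ^ 'd) set" where
  "holed E N n = {p. \<exists>q. coarsen N q = p \<and> q \<notin> grid_index (n + N) ` E}"

text \<open>
  As \<open>n j \<le> P * j\<close>, each \<open>j < L / P\<close> gives a level \<open>n j < L\<close>, and these levels are distinct. The box
  \<open>Q j\<close> is a missing descendant of the box of level \<open>n j\<close> around \<open>z\<close>. The points of \<open>E\<close> enter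
  only through the boxes that contain them: this is what makes a count of boxes possible.
\<close>

lemma box_mean_porous_holed_levels:
  fixes E :: "(real ^ 'd) set"
  assumes "box_mean_porous E"
  obtains N :: nat and P :: real where "N > 0" "P > 0"
    "\<And>z L. z \<in> E \<Longrightarrow> real L / P - 1 \<le> real (card {n. n < L \<and> grid_index n z \<in> holed E N n})"
proof -
  obtain N :: nat and P :: real where NP: "N > 0" "P > 0" and por: "\<forall>z\<in>E. \<exists>(n :: nat \<Rightarrow> nat) Q.
          strict_mono_on {1..} n \<and>
          (\<forall>j\<ge>1. real (n j) \<le> P * real j \<and> Q j \<in> dyadic_boxes (int (n j + N)) \<and>
                  Q j \<subseteq> dyadic_box_at z (int (n j)) - E)"
    using assms unfolding box_mean_porous_def by blast
  show thesis
  proof (rule that[OF NP])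
    fix z and L :: nat assume "z \<in> E"
    with por obtain n Q where mono: "strict_mono_on {1..} n"
      and nQ: "\<And>j. j \<ge> 1 \<Longrightarrow> real (n j) \<le> P * real j \<and> Q j \<in> dyadic_boxes (int (n j + N)) \<and>
                  Q j \<subseteq> dyadic_box_at z (int (n j)) - E"
      by blast
    have holed: "grid_index (n j) z \<in> holed E N (n j)" if j: "j \<ge> 1" for j
    proof -
      obtain q where q: "Q j = {x. grid_index (n j + N) x = q}"
        using nQ[OF j] unfolding dyadic_boxes_eq by blast
      have sub: "Q j \<subseteq> {x. grid_index (n j) x = grid_index (n j) z} - E"
        using nQ[OF j] by (simp add: dyadic_box_at_eq)
      \<comment> \<open>A box is nonempty, so any of its points, for instance the lower corner, identifies the
        larger box that contains it.\<close>
      let ?x = "(\<chi> i. real_of_int (q $ i) / 2 ^ (n j + N)) :: real ^ 'd"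
      have x: "grid_index (n j + N) ?x = q" by (rule grid_index_corner)
      then have "grid_index (n j) ?x = grid_index (n j) z" using sub q by blast
      then have "coarsen N q = grid_index (n j) z" using coarsen_grid_index[of N "n j" ?x] x by simp
      moreover have "q \<notin> grid_index (n j + N) ` E" using sub q by blast
      ultimately show ?thesis by (auto simp: holed_def)
    qed
    \<comment> \<open>The largest integer strictly below \<open>L / P\<close>, cut off at 0.\<close>
    let ?k = "nat (\<lceil>real L / P\<rceil> - 1)"
    have "n ` {1..?k} \<subseteq> {m. m < L \<and> grid_index m z \<in> holed E N m}"
    proof clarify
      fix j assume j: "j \<in> {1..?k}"
      then have "real j < real L / P" by (simp add: le_nat_iff) linarith
      then have "P * real j < real L" using NP by (simp add: field_simps)
      then show "n j < L \<and> grid_index (n j) z \<in> holed E N (n j)"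
        using nQ[of j] holed[of j] j by auto
    qed
    then have "card (n ` {1..?k}) \<le> card {m. m < L \<and> grid_index m z \<in> holed E N m}"
      by (intro card_mono) auto
    moreover have "inj_on n {1..?k}"
      using strict_mono_on_imp_inj_on[OF mono] by (rule inj_on_subset) auto
    ultimately have "?k \<le> card {m. m < L \<and> grid_index m z \<in> holed E N m}"
      by (simp add: card_image)
    then show "real L / P - 1 \<le> real (card {m. m < L \<and> grid_index m z \<in> holed E N m})"
      by linarith
  qed
qed

text \<open>
  The levels \<open>r + i * N\<close> are spaced so that the descendants counted for one of them are exactly the
  boxes of the next. Along them the boxes meeting \<open>E\<close> form a tree as in
  \<open>card_rarely_branching\<close>.
\<close>

lemma card_holed_residue_class:
  fixes E :: "(real ^ 'd) set"
  assumes E: "bounded E" and N: "N > 0" and D: "D = 2 ^ (N * CARD('d))"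
  shows "real (card (grid_index (r + k * N) `
             {z \<in> E. t \<le> real (card {i. i < k \<and> grid_index (r + i * N) z \<in> holed E N (r + i * N)})}))
           * (real D / (real D - 1)) powr t \<le> real D ^ k * real (card (grid_index r ` E))"
proof -
  let ?f = "\<lambda>k. grid_index (r + k * N)"
  have level: "r + Suc k * N = r + k * N + N" for k by simp
  have "real (card (?f k ` {z \<in> E. t \<le> real (card {i. i < k \<and> ?f i z \<in> holed E N (r + i * N)})}))
           * (real D / (real D - 1)) powr t \<le> real D ^ k * real (card (?f 0 ` E))"
  proof (rule card_rarely_branching[where g = "coarsen N"])
    show "finite (?f k ` E)" for k by (rule finite_grid_index_image[OF E])
    show "coarsen N (?f (Suc k) z) = ?f k z" for k z
      unfolding level by (rule coarsen_grid_index)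
    show "card {q \<in> ?f (Suc k) ` E. coarsen N q = p} \<le> D" for k p
      unfolding D card_coarsen_fibre(1)[of N p, symmetric]
      by (intro card_mono card_coarsen_fibre(2)) auto
    show "card {q \<in> ?f (Suc k) ` E. coarsen N q = p} < D" if "p \<in> holed E N (r + k * N)" for k p
      unfolding D card_coarsen_fibre(1)[of N p, symmetric]
    proof (rule psubset_card_mono[OF card_coarsen_fibre(2)])
      show "{q \<in> ?f (Suc k) ` E. coarsen N q = p} \<subset> {q. coarsen N q = p}"
        using that unfolding holed_def level by auto
    qed
    have "(2::nat) ^ 1 \<le> 2 ^ (N * CARD('d))" using N by (intro power_increasing) (auto simp: Suc_le_eq)
    then show "D \<ge> 2" by (simp add: D)
  qed
  then show ?thesis by simp
qed

lemma card_levels_by_residue: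
  fixes S :: "nat set"
  assumes "N > 0"
  shows "card {n. n < K * N \<and> n \<in> S} = (\<Sum>r<N. card {i. i < K \<and> r + i * N \<in> S})"
proof -
  let ?A = "SIGMA r:{..<N}. {i. i < K \<and> r + i * N \<in> S}"
  have "bij_betw (\<lambda>(r, i). r + i * N) ?A {n. n < K * N \<and> n \<in> S}"
  proof (rule bij_betw_byWitness[where f' = "\<lambda>n. (n mod N, n div N)"])
    show "(\<lambda>(r, i). r + i * N) ` ?A \<subseteq> {n. n < K * N \<and> n \<in> S}"
    proof
      fix n assume "n \<in> (\<lambda>(r, i). r + i * N) ` ?A"
      then obtain r i where n: "n = r + i * N" "r < N" "i < K" "r + i * N \<in> S" by auto
      have "Suc i * N \<le> K * N" using n by (intro mult_right_mono) auto
      then show "n \<in> {n. n < K * N \<and> n \<in> S}" using n by simp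
    qed
  qed (use assms in \<open>auto simp: less_mult_imp_div_less\<close>)
  then have "card {n. n < K * N \<and> n \<in> S} = card ?A" by (simp add: bij_betw_same_card)
  also have "\<dots> = (\<Sum>r<N. card {i. i < K \<and> r + i * N \<in> S})" by (subst card_SigmaI) auto
  finally show ?thesis .
qed

text \<open>
  Among the first \<open>k * N\<close> levels at least \<open>k * N / P - 1\<close> are holed, so some residue class contains at least
  \<open>k / P - 1\<close> of them. For each class the weighted count bounds the number of boxes by a constant
  times \<open>(D * lam powr (- 1 / P)) ^ k\<close>, with a base smaller than \<open>D\<close>.
\<close>

lemma box_mean_porous_few_boxes:
  fixes E :: "(real ^ 'd) set"
  assumes E: "bounded E" and "box_mean_porous E"
  obtains N :: nat and c rho :: real
  where "N > 0" "c \<ge> 1" "rho \<ge> 1" "rho < 2 ^ (N * CARD('d))"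
    "\<And>k. real (card (grid_index (k * N) ` E)) \<le> c * rho ^ k"
proof (rule box_mean_porous_holed_levels[OF assms(2)])
  fix N :: nat and P :: real
  assume N: "N > 0" and P: "P > 0" and many:
    "\<And>z L. z \<in> E \<Longrightarrow> real L / P - 1 \<le> real (card {n. n < L \<and> grid_index n z \<in> holed E N n})"
  define D :: nat where "D = 2 ^ (N * CARD('d))"
  define lam where "lam = real D / (real D - 1)"
  define h where "h = (\<lambda>r k z. card {i. i < k \<and> grid_index (r + i * N) z \<in> holed E N (r + i * N)})"
  \<comment> \<open>The maximum with 1 is taken, and the constant \<open>c\<close> contains an extra 1, so that the logarithm of the
    bound is nonnegative even if \<open>E\<close> is empty.\<close>
  define rho where "rho = max 1 (real D * lam powr (- 1 / P))"
  define c where "c = 1 + (\<Sum>r<N. lam * real (card (grid_index r ` E)))"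
  have "(2::nat) ^ 1 \<le> D" unfolding D_def using N by (intro power_increasing) (auto simp: Suc_le_eq)
  then have D: "D \<ge> 2" by simp
  then have lam: "lam > 1" by (simp add: lam_def field_simps)
  have "lam powr (- 1 / P) < 1" using lam P by (simp add: powr_less_one)
  then have rho_less: "rho < real D" using D by (simp add: rho_def)
  have pigeonhole: "\<exists>r<N. real k / P - 1 \<le> real (h r k z)" if z: "z \<in> E" for k z
  proof (rule ccontr)
    assume "\<not> ?thesis"
    then have small: "real (h r k z) < real k / P - 1" if "r < N" for r using that by force
    have "real (k * N) / P - 1 \<le> (\<Sum>r<N. real (h r k z))"
      using many[OF z, of "k * N"] card_levels_by_residue[OF N, of k "{n. grid_index n z \<in> holed E N n}"]
      by (simp add: h_def)
    also have "\<dots> < (\<Sum>r<N. real k / P - 1)"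
      by (rule sum_strict_mono) (use N small in auto)
    also have "\<dots> = real (k * N) / P - real N" by (simp add: field_simps)
    finally show False using N by linarith
  qed
  have count: "real (card (grid_index (k * N) ` E)) \<le> c * rho ^ k" for k
  proof -
    let ?t = "real k / P - 1"
    let ?G = "\<lambda>r. grid_index (r + k * N) ` {z \<in> E. ?t \<le> real (h r k z)}"
    have fin: "finite (?G r)" for r
      by (rule finite_subset[OF _ finite_grid_index_image[OF E, of "r + k * N"]]) auto
    \<comment> \<open>The tree for the residue class \<open>r\<close> has its boxes at level \<open>r + k * N\<close>, slightly below the
      level \<open>k * N\<close> at which all classes are compared.\<close>
    have "grid_index (k * N) ` E \<subseteq> (\<Union>r<N. coarsen r ` ?G r)"
    proof clarify
      fix z assume z: "z \<in> E"
      then obtain r where r: "r < N" "?t \<le> real (h r k z)" using pigeonhole by blast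
      have "grid_index (k * N) z = coarsen r (grid_index (r + k * N) z)"
        using coarsen_grid_index[of r "k * N" z] by (simp add: add.commute)
      then show "grid_index (k * N) z \<in> (\<Union>r<N. coarsen r ` ?G r)" using r z by blast
    qed
    then have "card (grid_index (k * N) ` E) \<le> card (\<Union>r<N. coarsen r ` ?G r)"
      by (rule card_mono[rotated]) (use fin in auto)
    also have "\<dots> \<le> (\<Sum>r<N. card (coarsen r ` ?G r))" by (rule card_UN_le) simp
    also have "\<dots> \<le> (\<Sum>r<N. card (?G r))" by (intro sum_mono card_image_le fin)
    finally have "real (card (grid_index (k * N) ` E)) \<le> (\<Sum>r<N. real (card (?G r)))"
      by (simp flip: of_nat_sum)
    also have "\<dots> \<le> (\<Sum>r<N. lam * real (card (grid_index r ` E)) * rho ^ k)"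
    proof (rule sum_mono)
      fix r
      have "real (card (?G r)) * lam powr ?t \<le> real D ^ k * real (card (grid_index r ` E))"
        unfolding lam_def h_def by (rule card_holed_residue_class[OF E N D_def])
      then have "real (card (?G r)) * lam powr ?t * lam powr (- ?t)
          \<le> real D ^ k * real (card (grid_index r ` E)) * lam powr (- ?t)"
        by (rule mult_right_mono) simp
      moreover have "lam powr ?t * lam powr (- ?t) = 1" using lam by (simp flip: powr_add)
      ultimately have "real (card (?G r))
          \<le> real D ^ k * real (card (grid_index r ` E)) * lam powr (- ?t)"
        by (simp add: mult.assoc)
      also have "lam powr (- ?t) = lam powr 1 * lam powr (- 1 / P * real k)"
        using powr_add[of lam 1 "- 1 / P * real k"] by simp
      also have "\<dots> = lam * (lam powr (- 1 / P)) ^ k"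
        using lam by (simp add: powr_powr flip: powr_realpow)
      finally have "real (card (?G r))
          \<le> lam * real (card (grid_index r ` E)) * (real D * lam powr (- 1 / P)) ^ k"
        by (simp add: power_mult_distrib mult_ac)
      also have "\<dots> \<le> lam * real (card (grid_index r ` E)) * rho ^ k"
        using lam by (intro mult_left_mono power_mono) (auto simp: rho_def)
      finally show "real (card (?G r)) \<le> lam * real (card (grid_index r ` E)) * rho ^ k" .
    qed
    also have "\<dots> = (c - 1) * rho ^ k" by (simp add: c_def sum_distrib_right)
    also have "\<dots> \<le> c * rho ^ k" by (intro mult_right_mono) (auto simp: rho_def)
    finally show ?thesis .
  qed
  show thesis
  proof (rule that[OF N _ _ _ count])
    show "c \<ge> 1" using lam by (simp add: c_def sum_nonneg)
    show "rho \<ge> 1" by (simp add: rho_def)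
    show "rho < 2 ^ (N * CARD('d))" using rho_less by (simp add: D_def)
  qed
qed

section \<open>From covers at geometric scales to the Minkowski dimension\<close>

lemma covering_number_le:
  assumes "finite C" "E \<subseteq> (\<Union>x\<in>C. cball x r)"
  shows "covering_number E r \<le> card C"
  unfolding covering_number_def by (rule Least_le) (use assms in blast)

text \<open>
  A radius \<open>r\<close> is compared with the next scale \<open>s / b ^ k \<le> r\<close>, for which \<open>k\<close> exceeds
  \<open>ln (1 / r) / ln b\<close> by at most a constant. So \<open>ln\<close> of the covering number is at most
  \<open>ln (1 / r) * (ln rho / ln b)\<close> plus a constant \<open>A\<close>, which disappears in the limit.
\<close>

lemma minkowski_dim_le:
  fixes E :: "'a :: metric_space set" and b c s rho :: real
  assumes b: "b > 1" and s: "s \<ge> 1" and c: "c \<ge> 1" and rho: "rho \<ge> 1"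
    and covers: "\<And>k. \<exists>C. finite C \<and> real (card C) \<le> c * rho ^ k \<and> E \<subseteq> (\<Union>x\<in>C. cball x (s / b ^ k))"
  shows "minkowski_dim E \<le> ereal (ln rho / ln b)"
proof -
  define A where "A = ln c + (ln s / ln b + 1) * ln rho"
  have bound: "ln (real (covering_number E r)) / ln (1 / r) \<le> A / ln (1 / r) + ln rho / ln b"
    if r: "0 < r" "r < 1" for r
  proof -
    define k where "k = nat \<lceil>ln (s / r) / ln b\<rceil>"
    have sr: "ln (s / r) = ln s + ln (1 / r)" using r s by (simp add: ln_div)
    have pos: "ln b > 0" "ln rho \<ge> 0" "ln (1 / r) > 0" "ln s \<ge> 0" using b rho r s by auto
    then have nn: "0 \<le> ln (s / r) / ln b" by (simp add: sr)
    have k: "ln (s / r) / ln b \<le> real k" "real k \<le> ln (s / r) / ln b + 1"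
      unfolding k_def using nn by linarith+
    have "ln (s / r) \<le> ln (b ^ k)" using k(1) pos b by (simp add: ln_realpow field_simps)
    then have "s / r \<le> b ^ k" using b s r by (subst (asm) ln_le_cancel_iff) auto
    then have rk: "s / b ^ k \<le> r" using b r by (simp add: field_simps)
    obtain C where C: "finite C" "real (card C) \<le> c * rho ^ k" "E \<subseteq> (\<Union>x\<in>C. cball x (s / b ^ k))"
      using covers by blast
    have "E \<subseteq> (\<Union>x\<in>C. cball x r)" using C(3) subset_cball[OF rk] by blast
    then have "real (covering_number E r) \<le> c * rho ^ k"
      using covering_number_le[OF C(1)] C(2) by (meson of_nat_le_iff order_trans)
    moreover have "1 \<le> c * rho ^ k" using c rho mult_mono[of 1 c 1 "rho ^ k"] by simp
    \<comment> \<open>For a covering number 0 the left side is \<open>ln 0 = 0\<close>; this is why the bound must be at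
      least 1.\<close>
    ultimately have "ln (real (covering_number E r)) \<le> ln (c * rho ^ k)"
      by (cases "covering_number E r = 0") auto
    also have "\<dots> = ln c + real k * ln rho" using c rho by (simp add: ln_mult ln_realpow)
    also have "\<dots> \<le> ln c + (ln (s / r) / ln b + 1) * ln rho"
      using k(2) pos by (intro add_left_mono mult_right_mono) auto
    also have "\<dots> = A + ln (1 / r) * (ln rho / ln b)"
      using pos by (simp add: A_def sr field_simps)
    finally have "ln (real (covering_number E r)) / ln (1 / r)
        \<le> (A + ln (1 / r) * (ln rho / ln b)) / ln (1 / r)"
      using pos by (intro divide_right_mono) auto
    also have "\<dots> = A / ln (1 / r) + ln rho / ln b" using pos by (simp add: add_divide_distrib)
    finally show ?thesis .
  qed
  have "((\<lambda>r. A / ln (1 / r) + ln rho / ln b) \<longlongrightarrow> 0 + ln rho / ln b) (at_right 0)"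
  proof (intro tendsto_add tendsto_const tendsto_divide_0[OF tendsto_const])
    have "filterlim (\<lambda>r :: real. ln (inverse r)) at_top (at_right 0)"
      by (rule filterlim_compose[OF ln_at_top filterlim_inverse_at_top_right])
    then show "filterlim (\<lambda>r :: real. ln (1 / r)) at_infinity (at_right 0)"
      by (simp add: inverse_eq_divide filterlim_at_top_imp_at_infinity)
  qed
  then have lim: "((\<lambda>r. ereal (A / ln (1 / r) + ln rho / ln b)) \<longlongrightarrow> ereal (ln rho / ln b)) (at_right 0)"
    by simp
  have "\<forall>\<^sub>F r in at_right (0::real). 0 < r \<and> r < 1"
    using eventually_at_right_less eventually_at_right_real[of 0 1] by (auto elim: eventually_mono)
  then have "\<forall>\<^sub>F r in at_right (0::real). ereal (ln (real (covering_number E r)) / ln (1 / r))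
      \<le> ereal (A / ln (1 / r) + ln rho / ln b)"
    by (rule eventually_mono) (use bound in auto)
  then have "minkowski_dim E \<le> Limsup (at_right 0) (\<lambda>r. ereal (A / ln (1 / r) + ln rho / ln b))"
    unfolding minkowski_dim_def by (rule Limsup_mono)
  also have "\<dots> = ereal (ln rho / ln b)" by (rule lim_imp_Limsup[OF _ lim]) simp
  finally show ?thesis .
qed

theorem proposition4p2:
  fixes E :: "(real ^ 'd) set"
  assumes "bounded E" and "box_mean_porous E"
  shows "minkowski_dim E < ereal (real CARD('d))"
proof (rule box_mean_porous_few_boxes[OF assms])
  fix N :: nat and c rho :: real
  assume N: "N > 0" and c: "c \<ge> 1" and rho: "rho \<ge> 1" "rho < 2 ^ (N * CARD('d))"
    and count: "\<And>k. real (card (grid_index (k * N) ` E)) \<le> c * rho ^ k"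
  have b: "(1::real) < 2 ^ N" using N by simp
  have le: "minkowski_dim E \<le> ereal (ln rho / ln (2 ^ N))"
  proof (rule minkowski_dim_le[OF b _ c rho(1)])
    show "1 \<le> real CARD('d)" by (simp add: Suc_le_eq)
    show "\<exists>C. finite C \<and> real (card C) \<le> c * rho ^ k \<and>
        E \<subseteq> (\<Union>x\<in>C. cball x (real CARD('d) / (2 ^ N) ^ k))" for k
    proof -
      have "(2::real) ^ (k * N) = (2 ^ N) ^ k" using power_mult[of "2::real" N k] by (simp add: mult.commute)
      moreover obtain C where C: "finite C" "card C \<le> card (grid_index (k * N) ` E)"
          "E \<subseteq> (\<Union>x\<in>C. cball x (real CARD('d) / 2 ^ (k * N)))"
        using cover_by_grid_cells[OF assms(1)] by blast
      moreover have "real (card C) \<le> c * rho ^ k" using C(2) count[of k] by linarith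
      ultimately show ?thesis by auto
    qed
  qed
  have "ln rho < ln ((2 ^ N) ^ CARD('d))"
    using rho by (simp add: power_mult)
  also have "\<dots> = real CARD('d) * ln (2 ^ N)"
    by (rule ln_realpow)
  finally have "ln rho / ln (2 ^ N) < real CARD('d)"
    using b by (subst pos_divide_less_eq) auto
  then show ?thesis using le by (simp add: le_less_trans)
qed

end
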